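(* Let $\mu>0$, let $a_1,a_2$ be real, put $X_1=a_1^2$, $X_2=a_2^2$, and let $$\Delta(r)=(r^2+X_1)(r^2+X_2)-\mu r^2=r^4+r^2(X_1+X_2-\mu)+X_1X_2 .$$ The zeros of $\Delta$ are given by $$2r_{1,2}^2=\mu-X_1-X_2\pm\sqrt{(\mu-X_1-X_2)^2-4X_1X_2}.$$ For these solutions to be real, that is, for horizons to be possible, the condition $$\mu\geq a_1^2+a_2^2+2|a_1a_2|=(|a_1|+|a_2|)^2$$ has to be fulfilled; thus the allowed values of $(a_1,a_2)$ are bounded and lie within a rhombus. If this condition is fulfilled, two horizons exist, because $\mu-X_1-X_2>\sqrt{(\mu-X_1-X_2)^2-4X_1X_2}$ for positive $X_1$ and $X_2$. If there is no rotation in one plane, that is, if $X_i=0$ for one $i$, one obtains the zeros of the horizon function $r^2+a^2-\mu$ of the metric with rotation in only one plane (with $a$ the remaining rotation parameter).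
   Context: $\Delta$ is the horizon function of the five-dimensional ($d=4$ space dimensions) Myers-Perry metric, a vacuum solution of the Einstein equations describing a black hole rotating in two independent planes. Here $\mu$ is the mass parameter and $a_1,a_2$ are the rotation (angular momentum) parameters of the two planes. The horizons are the sets of points at which $r$ is a real root of $\Delta$. For rotation in a single plane with parameter $a$, the horizon function of the five-dimensional Myers-Perry metric is $r^2+a^2-\mu$.
   Formalization: Since r=0 is a zero whenever a1 a2=0 (e.g. mu=1, a1=0, a2=2), the condition for horizons is stated for nonzero r, or for X1,X2>0; the two horizons may coincide at equality, and for X_i=0 the zeros of Delta also include r=0. *)

theory Defs
  imports "HOL-Analysis.Analysis"
begin

text \<open>The argument ranges over an arbitrary real field, so that the same horizon function can be
  read on the reals (whose roots are the horizons) and on the complex numbers (where all of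
  its zeros live, so that one can ask whether they are real).\<close>

definition horizon_fun :: "real \<Rightarrow> real \<Rightarrow> real \<Rightarrow> 'a::real_field \<Rightarrow> 'a" where
  "horizon_fun mu a1 a2 r =
     (r\<^sup>2 + of_real (a1\<^sup>2)) * (r\<^sup>2 + of_real (a2\<^sup>2)) - of_real mu * r\<^sup>2"

definition single_horizon_fun :: "real \<Rightarrow> real \<Rightarrow> 'a::real_field \<Rightarrow> 'a" where
  "single_horizon_fun mu a r = r\<^sup>2 + of_real (a\<^sup>2) - of_real mu"

text \<open>\<open>A\<close>, \<open>B\<close>, \<open>C\<close>, \<open>D\<close> are, in cyclic order, the vertices of a non-degenerate rhombus:
  a parallelogram with two adjacent sides of equal length.\<close>

definition rhombus :: "real \<times> real \<Rightarrow> real \<times> real \<Rightarrow> real \<times> real \<Rightarrow> real \<times> real \<Rightarrow> bool" where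
  "rhombus A B C D \<longleftrightarrow> \<not> collinear {A, B, C} \<and> B - A = C - D \<and> dist A B = dist B C"

end

(* With s = mu - a1^2 - a2^2 one has 4 Delta = (2 r^2 - s)^2 - D, which gives the zeros.  Dividing
   Delta(r) = 0 by r^2 gives mu = a1^2 + a2^2 + r^2 + (a1 a2)^2 / r^2, and AM-GM applied to the last
   two terms is exactly the necessary condition.  A zero r = 0 escapes this argument, but if all
   zeros are 0, then s = 0 = a1 a2 and the condition is an equality. *)

theory Submission
  imports Defs
begin

section \<open>Zeros of the horizon function by completing the square\<close>

lemma horizon_fun_square:
  fixes z :: "'a::real_field"
  shows "4 * horizon_fun mu a b z =
    (2 * z\<^sup>2 - of_real (mu - a\<^sup>2 - b\<^sup>2))\<^sup>2 - of_real ((mu - a\<^sup>2 - b\<^sup>2)\<^sup>2 - 4 * a\<^sup>2 * b\<^sup>2)"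
  unfolding horizon_fun_def by (simp add: power2_eq_square algebra_simps)

text \<open>Since \<open>w\<close> and \<open>- w\<close> enter symmetrically, any square root of
  the discriminant will do. Leaving \<open>w\<close> open serves \<open>sqrt\<close> over the reals
  and \<open>csqrt\<close> over the complex numbers alike.\<close>

lemma horizon_fun_eq_0_iff:
  fixes z w :: "'a::real_field"
  assumes "w\<^sup>2 = of_real ((mu - a\<^sup>2 - b\<^sup>2)\<^sup>2 - 4 * a\<^sup>2 * b\<^sup>2)"
  shows "horizon_fun mu a b z = 0 \<longleftrightarrow>
    2 * z\<^sup>2 = of_real (mu - a\<^sup>2 - b\<^sup>2) + w \<or> 2 * z\<^sup>2 = of_real (mu - a\<^sup>2 - b\<^sup>2) - w"
proof -
  let ?s = "of_real (mu - a\<^sup>2 - b\<^sup>2) :: 'a"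
  have "horizon_fun mu a b z = 0 \<longleftrightarrow> 4 * horizon_fun mu a b z = 0"
    by simp
  also have "\<dots> \<longleftrightarrow> (2 * z\<^sup>2 - ?s)\<^sup>2 = w\<^sup>2"
    unfolding horizon_fun_square assms by simp
  also have "\<dots> \<longleftrightarrow> 2 * z\<^sup>2 - ?s = w \<or> 2 * z\<^sup>2 - ?s = - w"
    by (rule power2_eq_iff)
  also have "\<dots> \<longleftrightarrow> 2 * z\<^sup>2 = ?s + w \<or> 2 * z\<^sup>2 = ?s - w"
    by (simp add: algebra_simps)
  finally show ?thesis .
qed

text \<open>\<open>sqrt\<close> of a negative real is minus the root of its absolute value, so for
  \<open>D < 0\<close> the two equations alone could have spurious solutions; hence the conjunct
  \<open>D \<ge> 0\<close>. In that case the completed square minus \<open>D\<close> is positive and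
  there is no real zero.\<close>

lemma real_horizon_fun_eq_0_iff:
  fixes r mu a b :: real
  defines "D \<equiv> (mu - a\<^sup>2 - b\<^sup>2)\<^sup>2 - 4 * a\<^sup>2 * b\<^sup>2"
  shows "horizon_fun mu a b r = 0 \<longleftrightarrow> D \<ge> 0 \<and>
    (2 * r\<^sup>2 = mu - a\<^sup>2 - b\<^sup>2 + sqrt D \<or> 2 * r\<^sup>2 = mu - a\<^sup>2 - b\<^sup>2 - sqrt D)"
proof (cases "D \<ge> 0")
  case True
  then show ?thesis
    using horizon_fun_eq_0_iff[of "sqrt D" mu a b r] by (simp add: D_def)
next
  case False
  moreover have "4 * horizon_fun mu a b r = (2 * r\<^sup>2 - (mu - a\<^sup>2 - b\<^sup>2))\<^sup>2 - D"
    by (simp only: horizon_fun_square D_def of_real_eq_id id_apply)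
  ultimately have "4 * horizon_fun mu a b r > 0"
    using zero_le_power2[of "2 * r\<^sup>2 - (mu - a\<^sup>2 - b\<^sup>2)"] by linarith
  with False show ?thesis by simp
qed

lemma horizon_fun_of_real:
  "horizon_fun mu a b (of_real r :: 'a::real_field) = of_real (horizon_fun mu a b r)"
  unfolding horizon_fun_def by simp

lemma horizon_fun_commute: "horizon_fun mu a b z = horizon_fun mu b a z"
  unfolding horizon_fun_def by (simp add: mult.commute)

text \<open>With one plane at rest every term contains z^2. Away from 0 the zeros are therefore
  those of the metric with a single rotation.\<close>

lemma horizon_fun_single_rotation:
  fixes z :: "'a::real_field"
  shows "horizon_fun mu 0 b z = z\<^sup>2 * single_horizon_fun mu b z"
  unfolding horizon_fun_def single_horizon_fun_def by (simp add: algebra_simps)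

section \<open>The bound on the rotation parameters and the discriminant\<close>

lemma sum_abs_power2: "a\<^sup>2 + b\<^sup>2 + 2 * \<bar>a * b\<bar> = (\<bar>a\<bar> + \<bar>b\<bar>)\<^sup>2" for a b :: real
  by (simp add: power2_sum abs_mult)

lemma nonzero_horizon_imp_bound:
  fixes r :: real
  assumes "r \<noteq> 0" and "horizon_fun mu a b r = 0"
  shows "a\<^sup>2 + b\<^sup>2 + 2 * \<bar>a * b\<bar> \<le> mu"
proof -
  have "mu * r\<^sup>2 = (r\<^sup>2 + a\<^sup>2) * (r\<^sup>2 + b\<^sup>2)"
    using assms(2) by (simp add: horizon_fun_def)
  \<comment> \<open>AM-GM as an identity, multiplied through by r^2; the final square is its defect
    and is dropped next.\<close>
  also have "\<dots> = (a\<^sup>2 + b\<^sup>2 + 2 * \<bar>a * b\<bar>) * r\<^sup>2 + (r\<^sup>2 - \<bar>a * b\<bar>)\<^sup>2"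
    by (simp add: power2_diff power_mult_distrib algebra_simps power2_eq_square)
  finally have "(a\<^sup>2 + b\<^sup>2 + 2 * \<bar>a * b\<bar>) * r\<^sup>2 \<le> mu * r\<^sup>2"
    by simp
  with assms(1) show ?thesis
    by simp
qed

text \<open>A difference of squares, written in terms of the slack in the bound. Under the bound,
  both the sign of the discriminant and its vanishing can be read off from the factors.\<close>

lemma discriminant_factor:
  fixes a b mu :: real
  shows "(mu - a\<^sup>2 - b\<^sup>2)\<^sup>2 - 4 * a\<^sup>2 * b\<^sup>2 =
    (mu - (a\<^sup>2 + b\<^sup>2 + 2 * \<bar>a * b\<bar>)) * (mu - (a\<^sup>2 + b\<^sup>2 + 2 * \<bar>a * b\<bar>) + 4 * \<bar>a * b\<bar>)"
proof -
  have "4 * a\<^sup>2 * b\<^sup>2 = (2 * \<bar>a * b\<bar>)\<^sup>2"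
    by (simp add: power_mult_distrib)
  then have "(mu - a\<^sup>2 - b\<^sup>2)\<^sup>2 - 4 * a\<^sup>2 * b\<^sup>2
      = (mu - a\<^sup>2 - b\<^sup>2 - 2 * \<bar>a * b\<bar>) * (mu - a\<^sup>2 - b\<^sup>2 + 2 * \<bar>a * b\<bar>)"
    by (simp add: power2_eq_square algebra_simps)
  then show ?thesis
    by (simp add: algebra_simps)
qed

lemma bound_imp_discriminant:
  fixes a b mu :: real
  assumes "a\<^sup>2 + b\<^sup>2 + 2 * \<bar>a * b\<bar> \<le> mu"
  shows "0 \<le> (mu - a\<^sup>2 - b\<^sup>2)\<^sup>2 - 4 * a\<^sup>2 * b\<^sup>2"
    and "sqrt ((mu - a\<^sup>2 - b\<^sup>2)\<^sup>2 - 4 * a\<^sup>2 * b\<^sup>2) \<le> mu - a\<^sup>2 - b\<^sup>2"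
    and "a \<noteq> 0 \<Longrightarrow> b \<noteq> 0 \<Longrightarrow> sqrt ((mu - a\<^sup>2 - b\<^sup>2)\<^sup>2 - 4 * a\<^sup>2 * b\<^sup>2) < mu - a\<^sup>2 - b\<^sup>2"
proof -
  show "0 \<le> (mu - a\<^sup>2 - b\<^sup>2)\<^sup>2 - 4 * a\<^sup>2 * b\<^sup>2"
    unfolding discriminant_factor using assms by simp
  \<comment> \<open>The discriminant is also nonnegative when s <= -2 |a b|, where neither value of
    r^2 is positive; the bound selects the branch s >= 2 |a b|.\<close>
  have s: "0 \<le> mu - a\<^sup>2 - b\<^sup>2"
    using assms abs_ge_zero[of "a * b"] by linarith
  show "sqrt ((mu - a\<^sup>2 - b\<^sup>2)\<^sup>2 - 4 * a\<^sup>2 * b\<^sup>2) \<le> mu - a\<^sup>2 - b\<^sup>2"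
    using s by (intro real_le_lsqrt) simp_all
  assume "a \<noteq> 0" "b \<noteq> 0"
  then have "0 < \<bar>a * b\<bar>" and "0 < 4 * a\<^sup>2 * b\<^sup>2"
    by simp_all
  with assms show "sqrt ((mu - a\<^sup>2 - b\<^sup>2)\<^sup>2 - 4 * a\<^sup>2 * b\<^sup>2) < mu - a\<^sup>2 - b\<^sup>2"
    by (intro real_less_lsqrt) linarith+
qed

section \<open>Reality of all complex zeros\<close>

lemma Reals_if_power2_nonneg:
  fixes z :: complex
  assumes "z\<^sup>2 = of_real x" and "0 \<le> x"
  shows "z \<in> \<real>"
proof -
  have "z\<^sup>2 = (of_real (sqrt x))\<^sup>2"
    using assms by (metis of_real_power real_sqrt_pow2)
  then have "z = of_real (sqrt x) \<or> z = - of_real (sqrt x)"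
    by (simp add: power2_eq_iff)
  then show ?thesis
    by auto
qed

text \<open>Existence of one real zero would be too weak a condition, as 0 is a zero whenever
  \<open>a * b = 0\<close>. Conversely, under the bound both values of z^2 are nonnegative reals,
  which forces z to be real.\<close>

lemma all_horizons_real_iff:
  "(\<forall>z::complex. horizon_fun mu a b z = 0 \<longrightarrow> z \<in> \<real>) \<longleftrightarrow> a\<^sup>2 + b\<^sup>2 + 2 * \<bar>a * b\<bar> \<le> mu"
    (is "?L \<longleftrightarrow> ?R")
proof
  let ?s = "mu - a\<^sup>2 - b\<^sup>2" and ?D = "(mu - a\<^sup>2 - b\<^sup>2)\<^sup>2 - 4 * a\<^sup>2 * b\<^sup>2"
  assume L: ?L
  show ?R
  proof (cases "\<exists>z::complex. z \<noteq> 0 \<and> horizon_fun mu a b z = 0")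
    case True
    then obtain z :: complex where z: "z \<noteq> 0" "horizon_fun mu a b z = 0"
      by blast
    with L obtain r where "z = of_real r"
      by (auto elim: Reals_cases)
    with z have "r \<noteq> 0" "horizon_fun mu a b r = 0"
      by (auto simp: horizon_fun_of_real)
    then show ?thesis
      by (rule nonzero_horizon_imp_bound)
  next
    case False
    define w where "w = csqrt (of_real ?D)"
    have w: "w\<^sup>2 = of_real ?D"
      by (simp add: w_def)
    \<comment> \<open>Both candidate values of z^2 have complex square roots. These are zeros of the
      horizon function, so by assumption they vanish, and s + w = 0 = s - w.\<close>
    have "2 * (csqrt ((of_real ?s + w) / 2))\<^sup>2 = of_real ?s + w"
      and "2 * (csqrt ((of_real ?s - w) / 2))\<^sup>2 = of_real ?s - w"
      by simp_all
    with False have "csqrt ((of_real ?s + w) / 2) = 0" "csqrt ((of_real ?s - w) / 2) = 0"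
      using horizon_fun_eq_0_iff[OF w] by blast+
    then have "of_real ?s + w = 0" "of_real ?s - w = 0"
      by (simp_all del: of_real_diff)
    then have "of_real ?s = (0 :: complex)" and "w = 0"
      by algebra+
    with w have "?s = 0" "?D = 0"
      unfolding of_real_eq_0_iff by (simp_all del: of_real_diff)
    then have "\<bar>a * b\<bar> = 0"
      by simp
    with \<open>?s = 0\<close> show ?thesis
      by linarith
  qed
next
  let ?s = "mu - a\<^sup>2 - b\<^sup>2" and ?D = "(mu - a\<^sup>2 - b\<^sup>2)\<^sup>2 - 4 * a\<^sup>2 * b\<^sup>2"
  assume R: ?R
  note disc = bound_imp_discriminant[OF R]
  show ?L
  proof (intro allI impI)
    fix z :: complex
    assume z: "horizon_fun mu a b z = 0"
    have "(of_real (sqrt ?D) :: complex)\<^sup>2 = of_real ?D"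
      using disc(1) by (metis of_real_power real_sqrt_pow2)
    from horizon_fun_eq_0_iff[OF this] z
    have "z\<^sup>2 = of_real ((?s + sqrt ?D) / 2) \<or> z\<^sup>2 = of_real ((?s - sqrt ?D) / 2)"
      by (auto simp: field_simps)
    moreover have "0 \<le> (?s - sqrt ?D) / 2"
      using disc(2) by simp
    moreover have "0 \<le> (?s + sqrt ?D) / 2"
      using disc(2) real_sqrt_ge_zero[OF disc(1)] by (intro divide_nonneg_pos) linarith+
    ultimately show "z \<in> \<real>"
      using Reals_if_power2_nonneg by blast
  qed
qed

section \<open>The two horizons when both planes rotate\<close>

lemma ex_two_horizons:
  fixes a b mu :: real
  defines "s \<equiv> mu - a\<^sup>2 - b\<^sup>2" and "D \<equiv> (mu - a\<^sup>2 - b\<^sup>2)\<^sup>2 - 4 * a\<^sup>2 * b\<^sup>2"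
  assumes bound: "a\<^sup>2 + b\<^sup>2 + 2 * \<bar>a * b\<bar> \<le> mu" and "a \<noteq> 0" and "b \<noteq> 0"
  obtains r1 r2 :: real where "0 < r2" "r2 \<le> r1" "2 * r1\<^sup>2 = s + sqrt D" "2 * r2\<^sup>2 = s - sqrt D"
    "{r::real. horizon_fun mu a b r = 0} = {r1, - r1, r2, - r2}"
    "\<forall>r::real. horizon_fun mu a b r = (r\<^sup>2 - r1\<^sup>2) * (r\<^sup>2 - r2\<^sup>2)"
    "r1 = r2 \<longleftrightarrow> mu = a\<^sup>2 + b\<^sup>2 + 2 * \<bar>a * b\<bar>"
proof -
  have D0: "0 \<le> D" and less: "sqrt D < s"
    unfolding D_def s_def using bound_imp_discriminant[OF bound] assms(4,5) by blast+
  have sD: "0 \<le> sqrt D"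
    using D0 by simp
  \<comment> \<open>The horizon radii are the nonnegative roots of the two values of r^2.\<close>
  define r1 where "r1 = sqrt ((s + sqrt D) / 2)"
  define r2 where "r2 = sqrt ((s - sqrt D) / 2)"
  have "0 \<le> s + sqrt D"
    using less sD by linarith
  then have r1: "2 * r1\<^sup>2 = s + sqrt D"
    by (simp add: r1_def)
  have r2: "2 * r2\<^sup>2 = s - sqrt D"
    using less by (simp add: r2_def)
  have pos: "0 < r2" and le: "r2 \<le> r1"
    using less sD by (simp_all add: r1_def r2_def)
  \<comment> \<open>Because \<open>D \<ge> 0\<close>, \<open>D\<close> is the square of
    \<open>sqrt D\<close> and the completed square splits over the reals. The factorisation also
    records multiplicities when the horizons coincide.\<close>
  have fac: "horizon_fun mu a b r = (r\<^sup>2 - r1\<^sup>2) * (r\<^sup>2 - r2\<^sup>2)" for r :: real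
  proof -
    have "4 * horizon_fun mu a b r = (2 * r\<^sup>2 - s)\<^sup>2 - (sqrt D)\<^sup>2"
      unfolding horizon_fun_square using D0 by (simp add: s_def D_def)
    also have "\<dots> = (2 * r\<^sup>2 - 2 * r1\<^sup>2) * (2 * r\<^sup>2 - 2 * r2\<^sup>2)"
      unfolding r1 r2 by (simp add: power2_eq_square algebra_simps)
    finally show ?thesis
      by (simp add: algebra_simps)
  qed
  have zeros: "{r::real. horizon_fun mu a b r = 0} = {r1, - r1, r2, - r2}"
    by (auto simp: fac power2_eq_iff)
  have "r1 = r2 \<longleftrightarrow> D = 0"
    by (auto simp: r1_def r2_def)
  also have "\<dots> \<longleftrightarrow> mu = a\<^sup>2 + b\<^sup>2 + 2 * \<bar>a * b\<bar>"
  proof -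
    \<comment> \<open>As \<open>a * b\<close> is nonzero, the second factor of the discriminant is
      positive, so \<open>D\<close> vanishes exactly when the slack in the bound does.\<close>
    have "0 < mu - (a\<^sup>2 + b\<^sup>2 + 2 * \<bar>a * b\<bar>) + 4 * \<bar>a * b\<bar>"
      using bound assms(4,5) by (intro add_nonneg_pos) simp_all
    then show ?thesis
      unfolding D_def discriminant_factor mult_eq_0_iff by linarith
  qed
  finally show thesis
    using that[OF pos le r1 r2 zeros] fac by blast
qed

section \<open>The rhombus of allowed rotation parameters\<close>

lemma convex_combination_4:
  assumes "convex S" "w \<in> S" "x \<in> S" "y \<in> S" "z \<in> S"
    and "0 \<le> a" "0 \<le> b" "0 \<le> c" "0 \<le> d" "a + b + c + d = (1::real)"
  shows "a *\<^sub>R w + b *\<^sub>R x + c *\<^sub>R y + d *\<^sub>R z \<in> S"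
proof -
  \<comment> \<open>Summing over list positions instead of over the set of points allows the points
    to coincide.\<close>
  have "(\<Sum>i\<in>{..<4::nat}. ([a, b, c, d] ! i) *\<^sub>R ([w, x, y, z] ! i)) \<in> S"
    using assms
    by (intro convex_sum) (auto simp: numeral_eq_Suc lessThan_Suc less_Suc_eq algebra_simps)
  then show ?thesis
    by (simp add: numeral_eq_Suc algebra_simps)
qed

text \<open>This is the ball of the 1-norm. It is convex by the triangle inequality and contains the
  vertices; conversely, explicit weights represent each of its points.\<close>

lemma convex_hull_cross:
  fixes s :: real
  assumes "0 < s"
  shows "convex hull {(s, 0), (0, s), (- s, 0), (0, - s)} = {(x, y). \<bar>x\<bar> + \<bar>y\<bar> \<le> s}"
    (is "convex hull ?V = ?B")
proof
  have "convex ?B"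
  proof (rule convexI)
    fix p q :: "real \<times> real" and u v :: real
    assume pq: "p \<in> ?B" "q \<in> ?B" and uv: "0 \<le> u" "0 \<le> v" "u + v = 1"
    have tri: "\<bar>u * x + v * y\<bar> \<le> u * \<bar>x\<bar> + v * \<bar>y\<bar>" for x y
      using uv by (metis abs_mult abs_of_nonneg abs_triangle_ineq)
    have "\<bar>u * fst p + v * fst q\<bar> + \<bar>u * snd p + v * snd q\<bar>
        \<le> u * (\<bar>fst p\<bar> + \<bar>snd p\<bar>) + v * (\<bar>fst q\<bar> + \<bar>snd q\<bar>)"
      using tri[of "fst p" "fst q"] tri[of "snd p" "snd q"] by (simp add: algebra_simps)
    also have "\<dots> \<le> u * s + v * s"
      using pq uv by (intro add_mono mult_left_mono) auto
    also have "\<dots> = s"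
      using uv(3) by (simp flip: distrib_right)
    finally show "u *\<^sub>R p + v *\<^sub>R q \<in> ?B"
      by (auto simp: case_prod_beta)
  qed
  moreover have "?V \<subseteq> ?B"
    using assms by auto
  ultimately show "convex hull ?V \<subseteq> ?B"
    by (intro hull_minimal)
next
  show "?B \<subseteq> convex hull ?V"
  proof clarify
    fix x y :: real
    assume xy: "\<bar>x\<bar> + \<bar>y\<bar> \<le> s"
    \<comment> \<open>the weight left over from \<open>\<bar>x\<bar> + \<bar>y\<bar>\<close> is split evenly between \<open>(s, 0)\<close> and \<open>(- s, 0)\<close>\<close>
    let ?a = "(s - \<bar>y\<bar> + x) / (2 * s)" and ?c = "(s - \<bar>y\<bar> - x) / (2 * s)"
      and ?b = "(\<bar>y\<bar> + y) / (2 * s)" and ?d = "(\<bar>y\<bar> - y) / (2 * s)"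
    have "?a *\<^sub>R (s, 0) + ?b *\<^sub>R (0, s) + ?c *\<^sub>R (- s, 0) + ?d *\<^sub>R (0, - s) \<in> convex hull ?V"
    proof (rule convex_combination_4)
      show "0 \<le> ?a" "0 \<le> ?b" "0 \<le> ?c" "0 \<le> ?d"
        using assms xy by (auto intro!: divide_nonneg_pos)
      show "?a + ?b + ?c + ?d = 1"
        using assms by (simp add: field_simps)
    qed (auto intro: hull_inc)
    moreover have "?a *\<^sub>R (s, 0) + ?b *\<^sub>R (0, s) + ?c *\<^sub>R (- s, 0) + ?d *\<^sub>R (0, - s) = (x, y)"
      using assms by (simp add: field_simps)
    ultimately show "(x, y) \<in> convex hull ?V"
      by simp
  qed
qed

lemma rhombus_cross:
  assumes "0 < s"
  shows "rhombus (s, 0) (0, s) (- s, 0) (0, - s)"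
proof -
  have "\<not> collinear {(s, 0), (0, s), (- s, 0)}"
  proof
    assume "collinear {(s, 0), (0, s), (- s, 0)}"
    \<comment> \<open>Both differences would be multiples of one vector \<open>u\<close>. The second
      is horizontal and nonzero, which makes \<open>u\<close> horizontal, but the first is not
      horizontal.\<close>
    then obtain u c d where "(s, 0) - (0, s) = c *\<^sub>R u" "(s, 0) - (- s, 0) = d *\<^sub>R u"
      unfolding collinear_def by blast
    with assms show False
      by (cases u) auto
  qed
  then show ?thesis
    unfolding rhombus_def by (simp add: dist_Pair_Pair dist_real_def)
qed

text \<open>The left side of the bound is a perfect square of |b1| + |b2|, so taking roots turns the
  region into the 1-norm ball of radius \<open>sqrt mu\<close>.\<close>

lemma allowed_rotations_eq_hull:
  assumes "0 < mu"
  shows "{(b1, b2). mu \<ge> b1\<^sup>2 + b2\<^sup>2 + 2 * \<bar>b1 * b2\<bar>} =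
    convex hull {(sqrt mu, 0), (0, sqrt mu), (- sqrt mu, 0), (0, - sqrt mu)}"
proof -
  have "b1\<^sup>2 + b2\<^sup>2 + 2 * \<bar>b1 * b2\<bar> \<le> mu \<longleftrightarrow> \<bar>b1\<bar> + \<bar>b2\<bar> \<le> sqrt mu" for b1 b2
    using real_sqrt_le_iff[of "(\<bar>b1\<bar> + \<bar>b2\<bar>)\<^sup>2" mu] by (simp add: sum_abs_power2)
  then show ?thesis
    using assms by (simp add: convex_hull_cross)
qed

section \<open>Horizons of the metric with two rotation parameters\<close>

theorem mainTheorem7:
  fixes mu a1 a2 X1 X2 D :: real
  assumes mu: "mu > 0"
    and X1: "X1 = a1\<^sup>2"
    and X2: "X2 = a2\<^sup>2"
    and D: "D = (mu - X1 - X2)\<^sup>2 - 4 * X1 * X2"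
  shows
    \<comment> \<open>expanded form\<close>
    "(\<forall>r::real. horizon_fun mu a1 a2 r = r ^ 4 + r\<^sup>2 * (X1 + X2 - mu) + X1 * X2)
    \<comment> \<open>the zeros, complex and real\<close>
    \<and> (\<forall>z::complex. horizon_fun mu a1 a2 z = 0 \<longleftrightarrow>
          2 * z\<^sup>2 = of_real (mu - X1 - X2) + csqrt (of_real D) \<or>
          2 * z\<^sup>2 = of_real (mu - X1 - X2) - csqrt (of_real D))
    \<and> (\<forall>r::real. horizon_fun mu a1 a2 r = 0 \<longleftrightarrow>
          D \<ge> 0 \<and> (2 * r\<^sup>2 = mu - X1 - X2 + sqrt D \<or> 2 * r\<^sup>2 = mu - X1 - X2 - sqrt D))
    \<comment> \<open>the condition for real solutions; \<open>r = 0\<close> is a zero whenever \<open>a1 * a2 = 0\<close>\<close>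
    \<and> a1\<^sup>2 + a2\<^sup>2 + 2 * \<bar>a1 * a2\<bar> = (\<bar>a1\<bar> + \<bar>a2\<bar>)\<^sup>2
    \<and> ((\<forall>z::complex. horizon_fun mu a1 a2 z = 0 \<longrightarrow> z \<in> \<real>) \<longleftrightarrow>
          mu \<ge> a1\<^sup>2 + a2\<^sup>2 + 2 * \<bar>a1 * a2\<bar>)
    \<and> ((\<exists>r::real. r \<noteq> 0 \<and> horizon_fun mu a1 a2 r = 0) \<longrightarrow>
          mu \<ge> a1\<^sup>2 + a2\<^sup>2 + 2 * \<bar>a1 * a2\<bar>)
    \<and> (X1 > 0 \<and> X2 > 0 \<longrightarrow>
          ((\<exists>r::real. horizon_fun mu a1 a2 r = 0) \<longleftrightarrow>
             mu \<ge> a1\<^sup>2 + a2\<^sup>2 + 2 * \<bar>a1 * a2\<bar>))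
    \<comment> \<open>the allowed rotation parameters\<close>
    \<and> bounded {(b1, b2). mu \<ge> b1\<^sup>2 + b2\<^sup>2 + 2 * \<bar>b1 * b2\<bar>}
    \<and> rhombus (sqrt mu, 0) (0, sqrt mu) (- sqrt mu, 0) (0, - sqrt mu)
    \<and> {(b1, b2). mu \<ge> b1\<^sup>2 + b2\<^sup>2 + 2 * \<bar>b1 * b2\<bar>} =
        convex hull {(sqrt mu, 0), (0, sqrt mu), (- sqrt mu, 0), (0, - sqrt mu)}
    \<comment> \<open>two horizons, coinciding exactly in the extremal case\<close>
    \<and> (mu \<ge> a1\<^sup>2 + a2\<^sup>2 + 2 * \<bar>a1 * a2\<bar> \<and> X1 > 0 \<and> X2 > 0 \<longrightarrow>
          D \<ge> 0 \<and> mu - X1 - X2 > sqrt D \<and>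
          (\<exists>r1 r2. 0 < r2 \<and> r2 \<le> r1 \<and>
             2 * r1\<^sup>2 = mu - X1 - X2 + sqrt D \<and>
             2 * r2\<^sup>2 = mu - X1 - X2 - sqrt D \<and>
             {r::real. horizon_fun mu a1 a2 r = 0} = {r1, - r1, r2, - r2} \<and>
             (\<forall>r::real. horizon_fun mu a1 a2 r = (r\<^sup>2 - r1\<^sup>2) * (r\<^sup>2 - r2\<^sup>2)) \<and>
             (r1 = r2 \<longleftrightarrow> mu = a1\<^sup>2 + a2\<^sup>2 + 2 * \<bar>a1 * a2\<bar>)))
    \<and> (mu > a1\<^sup>2 + a2\<^sup>2 + 2 * \<bar>a1 * a2\<bar> \<and> X1 > 0 \<and> X2 > 0 \<longrightarrow>
          card {r::real. r > 0 \<and> horizon_fun mu a1 a2 r = 0} = 2)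
    \<comment> \<open>no rotation in one plane\<close>
    \<and> (X1 = 0 \<longrightarrow>
          (\<forall>z::complex. horizon_fun mu a1 a2 z = z\<^sup>2 * single_horizon_fun mu a2 z) \<and>
          {z::complex. horizon_fun mu a1 a2 z = 0} =
            insert 0 {z. single_horizon_fun mu a2 z = 0} \<and>
          {r::real. horizon_fun mu a1 a2 r = 0} =
            insert 0 {r. single_horizon_fun mu a2 r = 0})
    \<and> (X2 = 0 \<longrightarrow>
          (\<forall>z::complex. horizon_fun mu a1 a2 z = z\<^sup>2 * single_horizon_fun mu a1 z) \<and>
          {z::complex. horizon_fun mu a1 a2 z = 0} =
            insert 0 {z. single_horizon_fun mu a1 z = 0} \<and>
          {r::real. horizon_fun mu a1 a2 r = 0} =
            insert 0 {r. single_horizon_fun mu a1 r = 0})"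
proof -
  let ?bound = "a1\<^sup>2 + a2\<^sup>2 + 2 * \<bar>a1 * a2\<bar>"
  have D': "D = (mu - a1\<^sup>2 - a2\<^sup>2)\<^sup>2 - 4 * a1\<^sup>2 * a2\<^sup>2"
    using D X1 X2 by simp
  have expand: "horizon_fun mu a1 a2 r = r ^ 4 + r\<^sup>2 * (X1 + X2 - mu) + X1 * X2" for r :: real
    unfolding horizon_fun_def X1 X2 by (simp add: algebra_simps flip: power_add)
  have zeros: "horizon_fun mu a1 a2 z = 0 \<longleftrightarrow>
      2 * z\<^sup>2 = of_real (mu - X1 - X2) + csqrt (of_real D) \<or>
      2 * z\<^sup>2 = of_real (mu - X1 - X2) - csqrt (of_real D)" for z :: complex
    unfolding X1 X2 by (rule horizon_fun_eq_0_iff) (simp add: D')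
  have real_zeros: "horizon_fun mu a1 a2 r = 0 \<longleftrightarrow>
      D \<ge> 0 \<and> (2 * r\<^sup>2 = mu - X1 - X2 + sqrt D \<or> 2 * r\<^sup>2 = mu - X1 - X2 - sqrt D)" for r :: real
    unfolding X1 X2 D' by (rule real_horizon_fun_eq_0_iff)
  have two: "D \<ge> 0 \<and> mu - X1 - X2 > sqrt D \<and>
      (\<exists>r1 r2. 0 < r2 \<and> r2 \<le> r1 \<and>
         2 * r1\<^sup>2 = mu - X1 - X2 + sqrt D \<and>
         2 * r2\<^sup>2 = mu - X1 - X2 - sqrt D \<and>
         {r::real. horizon_fun mu a1 a2 r = 0} = {r1, - r1, r2, - r2} \<and>
         (\<forall>r::real. horizon_fun mu a1 a2 r = (r\<^sup>2 - r1\<^sup>2) * (r\<^sup>2 - r2\<^sup>2)) \<and>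
         (r1 = r2 \<longleftrightarrow> mu = ?bound))"
    if "mu \<ge> ?bound" "X1 > 0" "X2 > 0"
  proof -
    have nz: "a1 \<noteq> 0" "a2 \<noteq> 0"
      using that X1 X2 by auto
    show ?thesis
      using bound_imp_discriminant[OF that(1)] nz ex_two_horizons[OF that(1) nz]
      unfolding D' X1 X2 by metis
  qed
  have ex_iff: "(\<exists>r::real. horizon_fun mu a1 a2 r = 0) \<longleftrightarrow> mu \<ge> ?bound" if "X1 > 0" "X2 > 0"
  proof
    assume "\<exists>r::real. horizon_fun mu a1 a2 r = 0"
    then obtain r :: real where r: "horizon_fun mu a1 a2 r = 0" ..
    \<comment> \<open>The value at 0 is \<open>X1 * X2\<close>, which is positive here.\<close>
    with that expand[of 0] have "r \<noteq> 0"
      by auto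
    then show "mu \<ge> ?bound"
      using r by (rule nonzero_horizon_imp_bound)
  qed (use two that in blast)
  have card: "card {r::real. r > 0 \<and> horizon_fun mu a1 a2 r = 0} = 2"
    if "mu > ?bound" "X1 > 0" "X2 > 0"
  proof -
    \<comment> \<open>Strictness of the bound excludes the extremal case, so the two positive radii
      are distinct.\<close>
    from two[OF less_imp_le[OF that(1)] that(2,3)] that(1) obtain r1 r2 :: real
      where r: "0 < r2" "r2 \<le> r1" "{r. horizon_fun mu a1 a2 r = 0} = {r1, - r1, r2, - r2}"
        "r1 \<noteq> r2"
      by (metis less_irrefl)
    have "{r. r > 0 \<and> horizon_fun mu a1 a2 r = 0} = {r. r > 0} \<inter> {r1, - r1, r2, - r2}"
      unfolding r(3)[symmetric] by auto
    also have "\<dots> = {r1, r2}"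
      using r(1,2) by auto
    finally show ?thesis
      using r(4) by simp
  qed
  have single1: "(\<forall>z::complex. horizon_fun mu a1 a2 z = z\<^sup>2 * single_horizon_fun mu a2 z) \<and>
      {z::complex. horizon_fun mu a1 a2 z = 0} = insert 0 {z. single_horizon_fun mu a2 z = 0} \<and>
      {r::real. horizon_fun mu a1 a2 r = 0} = insert 0 {r. single_horizon_fun mu a2 r = 0}"
    if "X1 = 0"
  proof -
    have "a1 = 0"
      using that X1 by simp
    then show ?thesis
      by (auto simp: horizon_fun_single_rotation)
  qed
  have single2: "(\<forall>z::complex. horizon_fun mu a1 a2 z = z\<^sup>2 * single_horizon_fun mu a1 z) \<and>
      {z::complex. horizon_fun mu a1 a2 z = 0} = insert 0 {z. single_horizon_fun mu a1 z = 0} \<and>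
      {r::real. horizon_fun mu a1 a2 r = 0} = insert 0 {r. single_horizon_fun mu a1 r = 0}"
    if "X2 = 0"
  proof -
    have "a2 = 0"
      using that X2 by simp
    then show ?thesis
      \<comment> \<open>Exchanging the planes reduces this to the case where the first one is at
        rest.\<close>
      by (auto simp: horizon_fun_commute[of mu a1 0] horizon_fun_single_rotation)
  qed
  have "bounded {(b1, b2). mu \<ge> b1\<^sup>2 + b2\<^sup>2 + 2 * \<bar>b1 * b2\<bar>}"
    unfolding allowed_rotations_eq_hull[OF mu] by (intro bounded_convex_hull) simp
  moreover have "rhombus (sqrt mu, 0) (0, sqrt mu) (- sqrt mu, 0) (0, - sqrt mu)"
    using mu by (intro rhombus_cross) simp
  moreover have "X1 > 0 \<and> X2 > 0 \<longrightarrow> ((\<exists>r::real. horizon_fun mu a1 a2 r = 0) \<longleftrightarrow> mu \<ge> ?bound)"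
    using ex_iff by blast
  moreover have "(\<exists>r::real. r \<noteq> 0 \<and> horizon_fun mu a1 a2 r = 0) \<longrightarrow> mu \<ge> ?bound"
    using nonzero_horizon_imp_bound by blast
  ultimately show ?thesis
    using expand zeros real_zeros sum_abs_power2[of a1 a2] all_horizons_real_iff[of mu a1 a2]
      allowed_rotations_eq_hull[OF mu] two card single1 single2
    by (intro conjI) (assumption | blast)+
qed

end
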